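(* Let $G$ be a hereditarily normal topological group. Then either (i) $G$ contains a non-trivial convergent sequence and $G$ has a $G_\delta$-diagonal, or (ii) $G$ contains no non-trivial convergent sequence and every compact subset of $G$ is finite. In either case every compact subset of $G$ is metrizable.
   Context: All spaces are assumed to be $T_1$. A space $X$ has a $G_\delta$-diagonal if $\{\langle x,x\rangle : x\in X\}$ is the intersection of a countable family of open subsets of $X\times X$. A non-trivial convergent sequence is a subspace homeomorphic to the subspace $\{0\}\cup\{1/n : n=1,2,3,\dots\}$ of the real line. *)

theory Defs
  imports "HOL-Analysis.Analysis"
begin

definition conv_seq_model :: "real set" where
  "conv_seq_model = {0} \<union> {1 / real n | n. n \<ge> 1}"

definition contains_nontrivial_convseq :: "'a topology \<Rightarrow> bool" where
  "contains_nontrivial_convseq X \<longleftrightarrow>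
     (\<exists>S. S \<subseteq> topspace X \<and>
          subtopology X S homeomorphic_space subtopology euclideanreal conv_seq_model)"

definition has_gdelta_diagonal :: "'a topology \<Rightarrow> bool" where
  "has_gdelta_diagonal X \<longleftrightarrow> gdelta_in (prod_topology X X) ((\<lambda>x. (x, x)) ` topspace X)"

end

(*
  Let a be a sequence of nonzero elements clustering at 0, and H a G_delta set containing 0 whose
  closure misses every a(n). Then H - closure (range a) and range a are separated, and disjoint open
  sets A and B around them force 0 to lie in a G_delta set contained in closure (range a), namely
  the points h of H with a(n) + h in B for all n: a point h of A cannot be among them, as a(n) + h
  clusters at h. (This is Katetov's argument for products, applied to the group operation.)
  If a converges to 0, the G_delta set is {0}, so the diagonal is a G_delta set, and compact sets
  are metrizable by Sneider's theorem.
  If there is merely an infinite compact set, a can be chosen inside a compact set, and 0 lies in a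
  compact G_delta subgroup N to which a subsequence of a converges modulo N. Shrinking N by Zorn's
  lemma, such a sequence of cosets of N can be lifted to a sequence of points converging to 0.
*)
theory Submission
  imports Defs
begin

section \<open>Sneider's metrization theorem\<close>

text \<open>The complement of each open set \<open>O' n\<close> around the diagonal is compact, so
  finitely many continuous real functions separate all the pairs in it. Over all \<open>n\<close>
  these countably many functions separate points, and evaluating them embeds the space in a
  countable product of real lines.\<close>

lemma compact_Hausdorff_gdelta_diagonal_imp_metrizable:
  assumes cpt: "compact_space X" and haus: "Hausdorff_space X" and diag: "has_gdelta_diagonal X"
  shows "metrizable_space X"
proof -
  have normal: "normal_space X"
    using cpt haus compact_Hausdorff_or_regular_imp_normal_space by blast
  \<comment> \<open>\<open>Q f\<close> collects the pairs of points that \<open>f\<close>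
    separates.\<close>
  define Q where "Q f = {p \<in> topspace (prod_topology X X). f (fst p) \<noteq> f (snd p)}"
    for f :: "'a \<Rightarrow> real"
  obtain O' where O': "\<And>n::nat. openin (prod_topology X X) (O' n)"
    and O'_eq: "\<Inter>(range O') = (\<lambda>x. (x, x)) ` topspace X"
    using diag unfolding has_gdelta_diagonal_def gdelta_in_descending by metis
  have openQ: "openin (prod_topology X X) (Q f)" if f: "continuous_map X euclideanreal f" for f
  proof -
    have "continuous_map (prod_topology X X) euclideanreal (\<lambda>p. f (fst p) - f (snd p))"
      using continuous_map_diff[OF continuous_map_compose[OF continuous_map_fst[of X X] f]
          continuous_map_compose[OF continuous_map_snd[of X X] f]]
      unfolding o_def .
    moreover have "openin euclideanreal (- {0})"
      by (simp add: open_Compl)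
    ultimately have "openin (prod_topology X X)
        {p \<in> topspace (prod_topology X X). f (fst p) - f (snd p) \<in> - {0}}"
      by (rule openin_continuous_map_preimage)
    then show ?thesis
      by (simp add: Q_def)
  qed
  have "\<exists>\<Phi>. finite \<Phi> \<and> (\<forall>f\<in>\<Phi>. continuous_map X euclideanreal f)
      \<and> topspace (prod_topology X X) - O' n \<subseteq> (\<Union>f\<in>\<Phi>. Q f)" for n
  proof -
    let ?R = "topspace (prod_topology X X) - O' n"
    have R: "compactin (prod_topology X X) ?R"
      using O' cpt by (simp add: closedin_compact_space closedin_diff compact_space_prod_topology del: topspace_prod_topology)
    have cover: "?R \<subseteq> \<Union>(Q ` {f. continuous_map X euclideanreal f})"
    proof
      fix p assume p: "p \<in> ?R"
      obtain x y where xy: "p = (x, y)" by fastforce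
      have "x \<in> topspace X" "y \<in> topspace X" "x \<noteq> y"
        using p xy O'_eq by auto
      moreover from this have "closedin X {x}" "closedin X {y}"
        using haus by (auto intro: closedin_Hausdorff_singleton)
      ultimately obtain f where "continuous_map X euclideanreal f" "f ` {x} \<subseteq> {0}" "f ` {y} \<subseteq> {1}"
        using Urysohn_lemma_alt[OF normal, of "{x}" "{y}" 0 1] by auto
      with p xy show "p \<in> \<Union>(Q ` {f. continuous_map X euclideanreal f})"
        by (intro UnionI[of "Q f"]) (auto simp: Q_def)
    qed
    have opens: "\<And>U. U \<in> Q ` {f. continuous_map X euclideanreal f} \<Longrightarrow> openin (prod_topology X X) U"
      using openQ by blast
    obtain \<F> where "finite \<F>" "\<F> \<subseteq> Q ` {f. continuous_map X euclideanreal f}" "?R \<subseteq> \<Union>\<F>"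
      using compactinD[OF R opens cover] by auto
    then obtain \<Phi> where "finite \<Phi>" "\<Phi> \<subseteq> {f. continuous_map X euclideanreal f}" "\<F> = Q ` \<Phi>"
      by (meson finite_subset_image)
    with \<open>?R \<subseteq> \<Union>\<F>\<close> show ?thesis
      by blast
  qed
  then obtain \<Phi> where fin: "\<And>n. finite (\<Phi> n)"
    and cont: "\<And>n f. f \<in> \<Phi> n \<Longrightarrow> continuous_map X euclideanreal f"
    and cov: "\<And>n. topspace (prod_topology X X) - O' n \<subseteq> (\<Union>f\<in>\<Phi> n. Q f)"
    by metis
  let ?I = "\<Union>n. \<Phi> n" and ?g = "\<lambda>x. \<lambda>f\<in>(\<Union>n. \<Phi> n). f x"
  let ?Y = "product_topology (\<lambda>f. euclideanreal) ?I"
  have "countable ?I"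
    using fin by (simp add: countable_finite)
  then have "metrizable_space ?Y"
    unfolding metrizable_space_product_topology
    by (intro disjI2 conjI ballI metrizable_space_euclidean) (rule countable_subset, auto)
  moreover have "embedding_map X ?Y ?g"
  proof (rule continuous_imp_embedding_map)
    show "Hausdorff_space ?Y"
      by (simp add: Hausdorff_space_product_topology)
    show "continuous_map X ?Y ?g"
      by (auto simp: continuous_map_componentwise cont)
    show "inj_on ?g (topspace X)"
    proof (rule inj_onI, rule ccontr)
      fix x y assume xy: "x \<in> topspace X" "y \<in> topspace X" "?g x = ?g y" "x \<noteq> y"
      then have "(x, y) \<notin> \<Inter>(range O')"
        unfolding O'_eq by auto
      then obtain n where "(x, y) \<in> topspace (prod_topology X X) - O' n"
        using xy by auto
      then obtain f where "f \<in> \<Phi> n" "f x \<noteq> f y"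
        using cov by (fastforce simp: Q_def)
      then show False
        using xy(3) by (metis (mono_tags, lifting) UN_I UNIV_I restrict_apply')
    qed
  qed (use cpt in auto)
  ultimately show ?thesis
    by (metis embedding_map_imp_homeomorphic_space homeomorphic_metrizable_space metrizable_space_subtopology)
qed

lemma has_gdelta_diagonal_subtopology:
  assumes "has_gdelta_diagonal X"
  shows "has_gdelta_diagonal (subtopology X S)"
proof -
  have "(\<lambda>x. (x, x)) ` topspace (subtopology X S) = (\<lambda>x. (x, x)) ` topspace X \<inter> S \<times> S"
    by auto
  then show ?thesis
    using assms unfolding has_gdelta_diagonal_def subtopology_Times[symmetric] gdelta_in_subtopology
    by blast
qed

section \<open>Lifting convergence modulo a compact subgroup\<close>

lemma open_add_preimage:
  fixes S :: "'a::topological_group_add set"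
  assumes "open S"
  shows "open {x. c + x \<in> S}" "open {x. x + c \<in> S}"
proof -
  have "open ((\<lambda>x. c + x) -` S)" "open ((\<lambda>x. x + c) -` S)"
    by (intro open_vimage assms continuous_intros)+
  then show "open {x. c + x \<in> S}" "open {x. x + c \<in> S}"
    by (simp_all add: vimage_def)
qed

lemma compact_add_image:
  fixes S :: "'a::topological_group_add set"
  assumes "compact S"
  shows "compact ((\<lambda>x. c + x) ` S)" "compact ((\<lambda>x. x + c) ` S)"
  by (intro compact_continuous_image assms continuous_intros)+

lemma zero_neighbourhood_diff:
  fixes W :: "'a::topological_group_add set"
  assumes "open W" "0 \<in> W"
  obtains V where "open V" "0 \<in> V" "V \<subseteq> W" "\<And>x y. x \<in> V \<Longrightarrow> y \<in> V \<Longrightarrow> x - y \<in> W"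
proof -
  have "open ((\<lambda>p::'a \<times> 'a. fst p - snd p) -` W)"
    by (intro open_vimage assms continuous_intros)
  then obtain A B where "open A" "open B" "(0, 0) \<in> A \<times> B"
    and AB: "A \<times> B \<subseteq> (\<lambda>p::'a \<times> 'a. fst p - snd p) -` W"
    by (rule open_prod_elim[of _ "(0, 0)"]) (use assms in auto)
  then show thesis
    using assms by (intro that[of "A \<inter> B \<inter> W"]) auto
qed

text \<open>A tube lemma for addition: continuity at each \<open>(0, x)\<close> gives boxes
  \<open>A x\<close>, \<open>B x\<close>; finitely many \<open>B x\<close> cover \<open>N\<close>,
  and the corresponding \<open>A x\<close> are intersected.\<close>

lemma tube_add:
  fixes N :: "'a::topological_group_add set"
  assumes "compact N" "open Q" "N \<subseteq> Q"
  obtains V where "open V" "0 \<in> V" "\<And>v x. v \<in> V \<Longrightarrow> x \<in> N \<Longrightarrow> v + x \<in> Q"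
proof -
  have "\<exists>A B. open A \<and> open B \<and> 0 \<in> A \<and> x \<in> B \<and> (\<forall>v\<in>A. \<forall>y\<in>B. v + y \<in> Q)" if x: "x \<in> N" for x
  proof -
    have "open ((\<lambda>p::'a \<times> 'a. fst p + snd p) -` Q)"
      by (intro open_vimage assms continuous_intros)
    then obtain A B where "open A" "open B" "(0, x) \<in> A \<times> B"
      and AB: "A \<times> B \<subseteq> (\<lambda>p::'a \<times> 'a. fst p + snd p) -` Q"
      by (rule open_prod_elim[of _ "(0, x)"]) (use assms x in auto)
    then show ?thesis
      by (intro exI[of _ A] exI[of _ B]) auto
  qed
  then obtain A B where AB: "\<And>x. x \<in> N \<Longrightarrow> open (A x) \<and> open (B x) \<and> 0 \<in> A x \<and> x \<in> B x"
    and sum: "\<And>x v y. x \<in> N \<Longrightarrow> v \<in> A x \<Longrightarrow> y \<in> B x \<Longrightarrow> v + y \<in> Q"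
    by metis
  have "N \<subseteq> (\<Union>x\<in>N. B x)"
    using AB by blast
  then obtain C where C: "C \<subseteq> N" "finite C" "N \<subseteq> (\<Union>x\<in>C. B x)"
    using compactE_image[OF assms(1), of N B] AB by metis
  show thesis
  proof (rule that[of "\<Inter>x\<in>C. A x"])
    show "open (\<Inter>x\<in>C. A x)" "0 \<in> (\<Inter>x\<in>C. A x)"
      using AB C by (auto intro!: open_INT)
    show "v + x \<in> Q" if v: "v \<in> (\<Inter>x\<in>C. A x)" and x: "x \<in> N" for v x
    proof -
      obtain y where "y \<in> C" "x \<in> B y"
        using C(3) x by auto
      then show ?thesis
        using sum[of y v x] v C(1) by auto
    qed
  qed
qed

section \<open>Chains of neighbourhoods and the closed subgroups they define\<close>

text \<open>The point is that \<open>\<Inter>(range W)\<close> is then a closed subgroup.\<close>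

definition subgroup_chain :: "(nat \<Rightarrow> 'a::topological_group_add set) \<Rightarrow> bool" where
  "subgroup_chain W \<longleftrightarrow> (\<forall>n. open (W n) \<and> 0 \<in> W n \<and> W (Suc n) \<subseteq> W n \<and>
     (\<forall>x\<in>W (Suc n). \<forall>y\<in>W (Suc n). x - y \<in> W n))"

text \<open>This places a closed G_delta subgroup inside any given G_delta set around 0. Each member
  is chosen by continuity of subtraction and then cut down by the next \<open>U n\<close>.\<close>

lemma subgroup_chain_exists:
  fixes U :: "nat \<Rightarrow> 'a::topological_group_add set"
  assumes U: "\<And>n. open (U n)" "\<And>n. 0 \<in> U n"
  obtains W where "subgroup_chain W" "\<And>n. W n \<subseteq> U n"
proof -
  have "\<exists>W. \<forall>n. (open (W n) \<and> 0 \<in> W n \<and> W n \<subseteq> U n) \<and>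
     (W (Suc n) \<subseteq> W n \<and> (\<forall>x\<in>W (Suc n). \<forall>y\<in>W (Suc n). x - y \<in> W n))"
  proof (rule dependent_nat_choice)
    show "\<exists>W. open W \<and> 0 \<in> W \<and> W \<subseteq> U 0"
      using U by blast
  next
    fix W n assume W: "open W \<and> 0 \<in> W \<and> W \<subseteq> U n"
    obtain V where "open V" "0 \<in> V" "V \<subseteq> W" "\<And>x y. x \<in> V \<Longrightarrow> y \<in> V \<Longrightarrow> x - y \<in> W"
      using zero_neighbourhood_diff W by metis
    then show "\<exists>V. (open V \<and> 0 \<in> V \<and> V \<subseteq> U (Suc n)) \<and> (V \<subseteq> W \<and> (\<forall>x\<in>V. \<forall>y\<in>V. x - y \<in> W))"
      using U by (intro exI[of _ "V \<inter> U (Suc n)"]) auto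
  qed
  then show thesis
    unfolding subgroup_chain_def by (metis that[unfolded subgroup_chain_def])
qed

lemma subgroup_chain_antimono: "subgroup_chain W \<Longrightarrow> m \<le> n \<Longrightarrow> W n \<subseteq> W m"
  unfolding subgroup_chain_def by (metis lift_Suc_antimono_le)

lemma subgroup_chain_closure:
  assumes "subgroup_chain W"
  shows "closure (W (Suc n)) \<subseteq> W n"
proof
  fix x assume x: "x \<in> closure (W (Suc n))"
  have W: "open (W (Suc n))" "0 \<in> W (Suc n)" "\<And>x y. x \<in> W (Suc n) \<Longrightarrow> y \<in> W (Suc n) \<Longrightarrow> x - y \<in> W n"
    using assms by (auto simp: subgroup_chain_def)
  \<comment> \<open>This set is the translate of \<open>W (Suc n)\<close> by \<open>x\<close> on the
    left, a neighbourhood of \<open>x\<close>. A common point \<open>y\<close> with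
    \<open>W (Suc n)\<close> exhibits \<open>x\<close> as a difference of two elements of
    \<open>W (Suc n)\<close>.\<close>
  have "open {y. - x + y \<in> W (Suc n)}" "x \<in> {y. - x + y \<in> W (Suc n)}"
    using W open_add_preimage by auto
  then obtain y where y: "y \<in> W (Suc n)" "- x + y \<in> W (Suc n)"
    using x open_Int_closure_eq_empty[of "{y. - x + y \<in> W (Suc n)}" "W (Suc n)"] by blast
  have "y - (- x + y) = x"
    by (simp only: diff_conv_add_uminus minus_add minus_minus add_minus_cancel)
  then show "x \<in> W n"
    using W(3)[OF y] by simp
qed

lemma subgroup_chain_Inter:
  assumes "subgroup_chain W"
  shows "0 \<in> \<Inter>(range W)" "x \<in> \<Inter>(range W) \<Longrightarrow> y \<in> \<Inter>(range W) \<Longrightarrow> x - y \<in> \<Inter>(range W)"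
    and "closed (\<Inter>(range W))"
proof -
  show "0 \<in> \<Inter>(range W)" "x \<in> \<Inter>(range W) \<Longrightarrow> y \<in> \<Inter>(range W) \<Longrightarrow> x - y \<in> \<Inter>(range W)"
    using assms by (auto simp: subgroup_chain_def)
  \<comment> \<open>Each closure lies in the preceding member, so passing to closures does not
    enlarge the intersection.\<close>
  have "\<Inter>(range W) = (\<Inter>n. closure (W n))"
  proof
    show "(\<Inter>n. closure (W n)) \<subseteq> \<Inter>(range W)"
      using subgroup_chain_closure[OF assms] by blast
  qed (use closure_subset in blast)
  then show "closed (\<Inter>(range W))"
    by (simp add: closed_INT)
qed

text \<open>Inside a compact set the neighbourhoods \<open>W k\<close> shrink to the subgroup: the
  complements of their closures cover \<open>K - Q\<close>, and by monotonicity the largest index of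
  a finite subcover suffices.\<close>

lemma subgroup_chain_compact:
  assumes W: "subgroup_chain W" and K: "compact K" and Q: "open Q" "K \<inter> \<Inter>(range W) \<subseteq> Q"
  obtains k where "K \<inter> closure (W k) \<subseteq> Q"
proof -
  have "compact (K - Q)"
    using K Q by (simp add: Diff_eq compact_Int_closed closed_Compl)
  moreover have "K - Q \<subseteq> (\<Union>k. - closure (W k))"
    using Q subgroup_chain_closure[OF W] by blast
  ultimately obtain C where C: "finite C" "K - Q \<subseteq> (\<Union>k\<in>C. - closure (W k))"
    using compactE_image[of "K - Q" UNIV "\<lambda>k. - closure (W k)"] by (auto simp: open_Compl)
  obtain m where "\<forall>k\<in>C. k \<le> m"
    using C(1) finite_nat_set_iff_bounded_le by blast
  then have "closure (W m) \<subseteq> closure (W k)" if "k \<in> C" for k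
    using closure_mono[OF subgroup_chain_antimono[OF W]] that \<open>\<forall>k\<in>C. k \<le> m\<close> by simp
  then have "K \<inter> closure (W m) \<subseteq> Q"
    using C(2) by fast
  then show thesis
    by (rule that)
qed

section \<open>Sequences of cosets converging to a compact subgroup\<close>

text \<open>\<open>F 0\<close> is a compact subgroup \<open>N\<close>, and \<open>F (Suc n)\<close> is the \<open>n\<close>-th member of a sequence of
  cosets of \<open>N\<close> converging to \<open>N\<close>. Indexing \<open>N\<close> together with its cosets makes the pointwise order
  on functions the order needed for Zorn's lemma.\<close>

definition coset_system :: "(nat \<Rightarrow> 'a::topological_group_add set) \<Rightarrow> bool" where
  "coset_system F \<longleftrightarrow> 0 \<in> F 0 \<and> (\<forall>x\<in>F 0. \<forall>y\<in>F 0. x - y \<in> F 0) \<and> compact (F 0) \<and> closed (F 0) \<and>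
     (\<forall>n. F (Suc n) \<noteq> {} \<and> (\<forall>c\<in>F (Suc n). F (Suc n) = {x. - c + x \<in> F 0})) \<and>
     (\<forall>Q. open Q \<and> F 0 \<subseteq> Q \<longrightarrow> (\<forall>\<^sub>F n in sequentially. F (Suc n) \<subseteq> Q))"

lemma coset_systemD:
  assumes "coset_system F"
  shows "0 \<in> F 0" "x \<in> F 0 \<Longrightarrow> y \<in> F 0 \<Longrightarrow> x - y \<in> F 0" "compact (F 0)" "closed (F 0)"
    and "F (Suc n) \<noteq> {}" "c \<in> F (Suc n) \<Longrightarrow> F (Suc n) = {x. - c + x \<in> F 0}"
    and "open Q \<Longrightarrow> F 0 \<subseteq> Q \<Longrightarrow> \<forall>\<^sub>F n in sequentially. F (Suc n) \<subseteq> Q"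
proof -
  note * = assms[unfolded coset_system_def]
  show "0 \<in> F 0" "compact (F 0)" "closed (F 0)"
    using * by simp_all
  show "x \<in> F 0 \<Longrightarrow> y \<in> F 0 \<Longrightarrow> x - y \<in> F 0" "F (Suc n) \<noteq> {}"
    "c \<in> F (Suc n) \<Longrightarrow> F (Suc n) = {x. - c + x \<in> F 0}"
    "open Q \<Longrightarrow> F 0 \<subseteq> Q \<Longrightarrow> \<forall>\<^sub>F n in sequentially. F (Suc n) \<subseteq> Q"
    using * by metis+
qed

lemma subgroup_add:
  fixes N :: "'a::group_add set"
  assumes "0 \<in> N" "\<And>x y. x \<in> N \<Longrightarrow> y \<in> N \<Longrightarrow> x - y \<in> N"
  shows "x \<in> N \<Longrightarrow> - x \<in> N" "x \<in> N \<Longrightarrow> y \<in> N \<Longrightarrow> x + y \<in> N"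
proof -
  show *: "- x \<in> N" if "x \<in> N" for x
    using assms(2)[OF assms(1) that] by simp
  show "x + y \<in> N" if "x \<in> N" "y \<in> N"
    using assms(2)[OF that(1) *[OF that(2)]] by simp
qed

text \<open>Convergence of the representatives \<open>d n\<close> to \<open>N\<close> passes to
  their whole left cosets: as soon as \<open>d n\<close> lies in \<open>V + N\<close>, so does
  \<open>d n + N\<close>, and \<open>V\<close> can be chosen with \<open>V + N\<close> inside
  \<open>Q\<close>.\<close>

lemma coset_system_translates:
  fixes N :: "'a::topological_group_add set"
  assumes N: "0 \<in> N" "\<And>x y. x \<in> N \<Longrightarrow> y \<in> N \<Longrightarrow> x - y \<in> N" "compact N" "closed N"
    and d: "\<And>Q. open Q \<Longrightarrow> N \<subseteq> Q \<Longrightarrow> \<forall>\<^sub>F n in sequentially. d n \<in> Q"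
  shows "coset_system (case_nat N (\<lambda>n. {x. - d n + x \<in> N}))"
proof -
  note add = subgroup_add[OF N(1,2)]
  have coset: "{x. - d n + x \<in> N} = {x. - c + x \<in> N}" if c: "- d n + c \<in> N" for n c
  proof -
    have "- c + x = - (- d n + c) + (- d n + x)" "- d n + x = (- d n + c) + (- c + x)" for x
      by (simp_all add: minus_add add.assoc)
    then show ?thesis
      using add c by (metis (no_types, lifting))
  qed
  have conv: "\<forall>\<^sub>F n in sequentially. {x. - d n + x \<in> N} \<subseteq> Q" if Q: "open Q" "N \<subseteq> Q" for Q
  proof -
    obtain V where V: "open V" "0 \<in> V" "\<And>v x. v \<in> V \<Longrightarrow> x \<in> N \<Longrightarrow> v + x \<in> Q"
      using tube_add[OF N(3) Q] by metis
    \<comment> \<open>As \<open>N\<close> is a subgroup, this is the open set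
      \<open>V + N\<close>.\<close>
    let ?VN = "\<Union>x\<in>N. {y. y + x \<in> V}"
    have "N \<subseteq> ?VN"
      using V(2) add by force
    then have "\<forall>\<^sub>F n in sequentially. d n \<in> ?VN"
      by (intro d) (auto intro: open_add_preimage V(1))
    then show ?thesis
    proof eventually_elim
      case (elim n)
      then obtain y where y: "y \<in> N" "d n + y \<in> V"
        by blast
      have "x = (d n + y) + (- y + (- d n + x))" for x
        by (simp add: add.assoc)
      then show ?case
        using V(3)[OF y(2)] add y(1) by (metis (no_types, lifting) mem_Collect_eq subsetI)
    qed
  qed
  have "{x. - d n + x \<in> N} \<noteq> {}" for n
    using N(1) by (metis (mono_tags, lifting) empty_Collect_eq left_minus)
  with N coset conv show ?thesis
    unfolding coset_system_def by simp
qed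

lemma coset_system_closed:
  assumes "coset_system F"
  shows "closed (F n)"
proof (cases n)
  case 0
  then show ?thesis using assms by (simp add: coset_system_def)
next
  case (Suc m)
  obtain c where "c \<in> F (Suc m)"
    using coset_systemD(5)[OF assms] by blast
  then have "F n = {x. - c + x \<in> F 0}"
    using coset_systemD(6)[OF assms] Suc by simp
  then have "- F n = {x. - c + x \<in> - F 0}"
    by auto
  moreover have "open (- F 0)"
    using assms by (simp add: coset_system_def open_Compl)
  ultimately show ?thesis
    unfolding closed_def by (simp only: open_add_preimage(1))
qed

lemma coset_system_compact:
  assumes "coset_system F"
  shows "compact (F n)"
proof (cases n)
  case 0
  then show ?thesis using assms by (simp add: coset_system_def)
next
  case (Suc m)
  obtain c where "c \<in> F (Suc m)"
    using coset_systemD(5)[OF assms] by blast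
  then have F: "F n = {x. - c + x \<in> F 0}"
    using coset_systemD(6)[OF assms] Suc by simp
  have "F n = (\<lambda>x. c + x) ` F 0"
  proof
    show "F n \<subseteq> (\<lambda>x. c + x) ` F 0"
    proof
      fix x assume "x \<in> F n"
      then show "x \<in> (\<lambda>x. c + x) ` F 0"
        unfolding F by (intro image_eqI[of _ _ "- c + x"]) simp_all
    qed
  qed (auto simp: F)
  then show ?thesis
    using compact_add_image(1)[OF coset_systemD(3)[OF assms]] by simp
qed

text \<open>This supplies the lower bounds for Zorn's lemma. Compactness keeps the intersected
  cosets nonempty, and convergence is inherited from a single member of the chain.\<close>

lemma coset_system_Inter:
  fixes \<C> :: "(nat \<Rightarrow> 'a::topological_group_add set) set"
  assumes ne: "\<C> \<noteq> {}" and cs: "\<And>F. F \<in> \<C> \<Longrightarrow> coset_system F"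
    and chain: "\<And>F G. F \<in> \<C> \<Longrightarrow> G \<in> \<C> \<Longrightarrow> F \<le> G \<or> G \<le> F"
  shows "coset_system (\<lambda>n. \<Inter>F\<in>\<C>. F n)"
proof -
  obtain F0 where F0: "F0 \<in> \<C>"
    using ne by blast
  have least: "\<exists>G\<in>\<C>. \<forall>F\<in>\<F>. G \<le> F" if "finite \<F>" "\<F> \<subseteq> \<C>" for \<F>
    using that
  proof (induction \<F>)
    case (insert F \<F>)
    then obtain G where G: "G \<in> \<C>" "\<forall>F\<in>\<F>. G \<le> F"
      by blast
    then show ?case
      using chain[of F G] insert.prems by (metis insert_iff insert_subset order.refl order.trans)
  qed (use F0 in blast)
  \<comment> \<open>The sets \<open>F n\<close> are closed and every finite subfamily of the chain
    has a lower bound in it, so the finite intersection property applies.\<close>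
  have compact_meet: "K \<inter> (\<Inter>F\<in>\<C>. F n) \<noteq> {}"
    if "compact K" "\<And>F. F \<in> \<C> \<Longrightarrow> K \<inter> F n \<noteq> {}" for K n
  proof (rule compact_imp_fip_image[OF that(1)])
    show "closed (F n)" if "F \<in> \<C>" for F
      using coset_system_closed[OF cs[OF that]] .
    show "K \<inter> (\<Inter>F\<in>\<F>. F n) \<noteq> {}" if \<F>: "finite \<F>" "\<F> \<subseteq> \<C>" for \<F>
    proof -
      obtain G where "G \<in> \<C>" "\<forall>F\<in>\<F>. G \<le> F"
        using least[OF \<F>] by blast
      then have "K \<inter> G n \<subseteq> K \<inter> (\<Inter>F\<in>\<F>. F n)"
        by (auto simp: le_fun_def)
      then show ?thesis
        using that(2) \<open>\<And>F. F \<in> \<C> \<Longrightarrow> K \<inter> F n \<noteq> {}\<close>[OF \<open>G \<in> \<C>\<close>] by blast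
    qed
  qed
  let ?N = "\<Inter>F\<in>\<C>. F 0"
  have "0 \<in> ?N" "\<forall>x\<in>?N. \<forall>y\<in>?N. x - y \<in> ?N"
    using cs by (auto simp: coset_system_def)
  moreover have "closed ?N"
    using coset_system_closed cs by (intro closed_INT) blast
  moreover have "compact ?N"
  proof -
    have "?N = F0 0 \<inter> ?N"
      using F0 by blast
    then show ?thesis
      using coset_system_compact[OF cs[OF F0]] \<open>closed ?N\<close> by (metis compact_Int_closed)
  qed
  moreover have "(\<Inter>F\<in>\<C>. F (Suc n)) \<noteq> {}" for n
  proof -
    have "F0 (Suc n) \<inter> (\<Inter>F\<in>\<C>. F (Suc n)) \<noteq> {}"
    proof (rule compact_meet)
      fix F assume F: "F \<in> \<C>"
      have "F0 (Suc n) \<noteq> {}" "F (Suc n) \<noteq> {}"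
        using cs F F0 by (auto simp: coset_system_def)
      moreover have "F (Suc n) \<subseteq> F0 (Suc n) \<or> F0 (Suc n) \<subseteq> F (Suc n)"
        using chain[OF F F0] by (auto simp: le_fun_def)
      ultimately show "F0 (Suc n) \<inter> F (Suc n) \<noteq> {}"
        by blast
    qed (rule coset_system_compact[OF cs[OF F0]])
    then show ?thesis
      by blast
  qed
  moreover have "(\<Inter>F\<in>\<C>. F (Suc n)) = {x. - c + x \<in> ?N}" if c: "c \<in> (\<Inter>F\<in>\<C>. F (Suc n))" for n c
  proof -
    have "F (Suc n) = {x. - c + x \<in> F 0}" if "F \<in> \<C>" for F
      using coset_systemD(6)[OF cs[OF that]] c that by simp
    then show ?thesis
      by auto
  qed
  moreover have "\<forall>\<^sub>F n in sequentially. (\<Inter>F\<in>\<C>. F (Suc n)) \<subseteq> Q" if Q: "open Q" "?N \<subseteq> Q" for Q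
  proof -
    \<comment> \<open>Otherwise the compact set \<open>F0 0 - Q\<close> would meet every
      \<open>F 0\<close>, hence also their intersection, which lies in \<open>Q\<close>.\<close>
    have "\<exists>F\<in>\<C>. F 0 \<subseteq> Q"
    proof (rule ccontr)
      assume no: "\<not> (\<exists>F\<in>\<C>. F 0 \<subseteq> Q)"
      have "(F0 0 - Q) \<inter> ?N \<noteq> {}"
      proof (rule compact_meet)
        show "compact (F0 0 - Q)"
          using coset_system_compact[OF cs[OF F0]] Q(1)
          by (simp add: Diff_eq compact_Int_closed closed_Compl)
        fix F assume F: "F \<in> \<C>"
        have "F 0 \<subseteq> F0 0 \<or> F0 0 \<subseteq> F 0"
          using chain[OF F F0] by (auto simp: le_fun_def)
        then show "(F0 0 - Q) \<inter> F 0 \<noteq> {}"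
          using no F F0 by blast
      qed
      then show False
        using Q(2) by blast
    qed
    then obtain F where F: "F \<in> \<C>" "F 0 \<subseteq> Q"
      by blast
    then have "\<forall>\<^sub>F n in sequentially. F (Suc n) \<subseteq> Q"
      using cs Q(1) by (simp add: coset_system_def)
    then show ?thesis
      by eventually_elim (use F in blast)
  qed
  ultimately show ?thesis
    unfolding coset_system_def by presburger
qed

text \<open>The subgroup is cut down by the intersection of a chain \<open>W\<close> avoiding
  \<open>x\<close>. Convergence survives if the representative \<open>d n\<close> of the new coset
  is taken as deep in the chain as \<open>F (Suc n)\<close> permits, up to level
  \<open>n\<close>.\<close>

lemma coset_system_refine:
  fixes F :: "nat \<Rightarrow> 'a::{topological_group_add, t1_space} set"
  assumes F: "coset_system F" and x: "x \<in> F 0" "x \<noteq> 0"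
  obtains G where "coset_system G" "G \<le> F" "x \<notin> G 0"
proof -
  note FD = coset_systemD[OF F]
  note add = subgroup_add[OF FD(1,2)]
  have "open (UNIV - {x})" "0 \<in> UNIV - {x}"
    using x by auto
  then obtain W where W: "subgroup_chain W" and Wx: "\<And>n. W n \<subseteq> UNIV - {x}"
    using subgroup_chain_exists[of "\<lambda>_. UNIV - {x}"] by blast
  note WI = subgroup_chain_Inter[OF W]
  have W_open: "open (W k)" "0 \<in> W k" for k
    using W by (auto simp: subgroup_chain_def)
  let ?N = "F 0 \<inter> \<Inter>(range W)"
  have N: "0 \<in> ?N" "\<And>x y. x \<in> ?N \<Longrightarrow> y \<in> ?N \<Longrightarrow> x - y \<in> ?N" "compact ?N" "closed ?N"
    using FD(1-4) WI by (simp_all add: compact_Int_closed closed_Int)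
  have meets: "\<forall>\<^sub>F n in sequentially. F (Suc n) \<inter> W k \<noteq> {}" for k
  proof -
    \<comment> \<open>This is the neighbourhood \<open>W k + F 0\<close> of \<open>F 0\<close>; a
      coset of \<open>F 0\<close> contained in it must meet \<open>W k\<close>.\<close>
    let ?WF = "\<Union>y\<in>F 0. {z. z + y \<in> W k}"
    have "open ?WF"
      using W_open by (auto intro: open_add_preimage)
    moreover have "F 0 \<subseteq> ?WF"
      using add W_open by force
    ultimately have "\<forall>\<^sub>F n in sequentially. F (Suc n) \<subseteq> ?WF"
      by (rule FD(7))
    then show ?thesis
    proof eventually_elim
      case (elim n)
      obtain c where c: "c \<in> F (Suc n)"
        using FD(5) by blast
      then obtain y where y: "y \<in> F 0" "c + y \<in> W k"
        using elim by blast
      then have "c + y \<in> F (Suc n)"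
        using FD(6)[OF c] by simp
      with y show ?case
        by blast
    qed
  qed
  \<comment> \<open>A point of the coset in the deepest level met so far also lies in all earlier
    levels, since the chain decreases.\<close>
  have "\<exists>c\<in>F (Suc n). \<forall>k\<le>m. F (Suc n) \<inter> W k \<noteq> {} \<longrightarrow> c \<in> W k" for n m
  proof (induction m)
    case 0
    show ?case
      using FD(5)[of n] by (cases "F (Suc n) \<inter> W 0 = {}") auto
  next
    case (Suc m)
    show ?case
    proof (cases "F (Suc n) \<inter> W (Suc m) = {}")
      case True
      then show ?thesis
        using Suc le_Suc_eq by metis
    next
      case False
      then obtain c where "c \<in> F (Suc n)" "c \<in> W (Suc m)"
        by blast
      then show ?thesis
        using subgroup_chain_antimono[OF W, of _ "Suc m"] by blast
    qed
  qed
  then have "\<forall>n. \<exists>c. c \<in> F (Suc n) \<and> (\<forall>k\<le>n. F (Suc n) \<inter> W k \<noteq> {} \<longrightarrow> c \<in> W k)"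
    by blast
  then obtain d where d: "\<And>n. d n \<in> F (Suc n)"
    and dW: "\<And>n k. k \<le> n \<Longrightarrow> F (Suc n) \<inter> W k \<noteq> {} \<Longrightarrow> d n \<in> W k"
    by metis
  have "\<forall>\<^sub>F n in sequentially. d n \<in> Q" if Q: "open Q" "?N \<subseteq> Q" for Q
  proof -
    obtain k where "F 0 \<inter> closure (W k) \<subseteq> Q"
      using subgroup_chain_compact[OF W FD(3) Q] .
    \<comment> \<open>The open set on the right contains \<open>F 0\<close>, so it eventually
      contains \<open>F (Suc n)\<close>. Since \<open>d n\<close> eventually lies in
      \<open>W k\<close>, only the part \<open>Q\<close> remains for it.\<close>
    then have "F 0 \<subseteq> Q \<union> - closure (W k)"
      by blast
    then have "\<forall>\<^sub>F n in sequentially. F (Suc n) \<subseteq> Q \<union> - closure (W k)"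
      using Q(1) by (intro FD(7)) (auto simp: open_Compl)
    then show ?thesis
      using meets[of k] eventually_ge_at_top[of k]
    proof eventually_elim
      case (elim n)
      then have "d n \<in> closure (W k)"
        using dW closure_subset by blast
      then show ?case
        using elim d by blast
    qed
  qed
  from coset_system_translates[OF N this] show thesis
  proof (rule that)
    show "case_nat ?N (\<lambda>n. {x. - d n + x \<in> ?N}) \<le> F"
    proof (rule le_funI)
      show "case_nat ?N (\<lambda>n. {x. - d n + x \<in> ?N}) n \<subseteq> F n" for n
        using FD(6)[OF d] by (cases n) auto
    qed
    show "x \<notin> case_nat ?N (\<lambda>n. {x. - d n + x \<in> ?N}) 0"
      using Wx by auto
  qed
qed

text \<open>Zorn's lemma yields a minimal coset system below the cosets of \<open>N\<close>. A
  nonzero point of its subgroup would allow a refinement, so the subgroup is trivial and convergence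
  of its cosets becomes convergence of points to 0.\<close>

lemma compact_subgroup_lift_sequence:
  fixes N :: "'a::{topological_group_add, t1_space} set"
  assumes N: "0 \<in> N" "\<And>x y. x \<in> N \<Longrightarrow> y \<in> N \<Longrightarrow> x - y \<in> N" "compact N" "closed N"
    and d: "\<And>Q. open Q \<Longrightarrow> N \<subseteq> Q \<Longrightarrow> \<forall>\<^sub>F n in sequentially. d n \<in> Q"
  obtains e where "e \<longlonglongrightarrow> 0" "\<And>n. - d n + e n \<in> N"
proof -
  define F0 where "F0 = case_nat N (\<lambda>n. {x. - d n + x \<in> N})"
  define A where "A = {F. coset_system F \<and> F \<le> F0}"
  have F0: "F0 \<in> A"
    unfolding A_def F0_def using coset_system_translates[OF N d] by simp
  \<comment> \<open>The order is reversed: a maximal element for Zorn's lemma is a smallest coset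
    system.\<close>
  have "\<exists>M\<in>A. \<forall>F\<in>A. F \<le> M \<longrightarrow> F = M"
  proof (rule predicate_Zorn)
    show "partial_order_on A (relation_of (\<lambda>F G. G \<le> F) A)"
      by (rule partial_order_on_relation_ofI) auto
  next
    fix \<C> assume \<C>: "\<C> \<in> Chains (relation_of (\<lambda>F G. G \<le> F) A)"
    then have sub: "\<C> \<subseteq> A" and chain: "\<And>F G. F \<in> \<C> \<Longrightarrow> G \<in> \<C> \<Longrightarrow> F \<le> G \<or> G \<le> F"
      by (auto simp: Chains_def relation_of_def)
    show "\<exists>U\<in>A. \<forall>F\<in>\<C>. U \<le> F"
    proof (cases "\<C> = {}")
      case False
      have lower: "(\<lambda>n. \<Inter>F\<in>\<C>. F n) \<le> F" if "F \<in> \<C>" for F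
        using that by (auto simp: le_fun_def)
      have "coset_system (\<lambda>n. \<Inter>F\<in>\<C>. F n)"
        using sub chain by (intro coset_system_Inter[OF False]) (auto simp: A_def)
      moreover obtain F where "F \<in> \<C>"
        using False by blast
      ultimately have "(\<lambda>n. \<Inter>F\<in>\<C>. F n) \<in> A"
        using lower[of F] sub order.trans unfolding A_def by blast
      with lower show ?thesis
        by blast
    qed (use F0 in blast)
  qed
  then obtain M where M: "coset_system M" "M \<le> F0"
    and min: "\<And>F. coset_system F \<Longrightarrow> F \<le> M \<Longrightarrow> F = M"
    unfolding A_def using order.trans by blast
  note MD = coset_systemD[OF M(1)]
  have "x = 0" if "x \<in> M 0" for x
    using coset_system_refine[OF M(1) that] min that by metis
  then have M0: "M 0 = {0}"
    using MD(1) by blast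
  have "\<forall>n. \<exists>y. y \<in> M (Suc n)"
    using MD(5) by blast
  then obtain e where e: "\<And>n. e n \<in> M (Suc n)"
    by metis
  show thesis
  proof
    show "e \<longlonglongrightarrow> 0"
    proof (rule topological_tendstoI)
      fix Q :: "'a set" assume "open Q" "0 \<in> Q"
      then have "\<forall>\<^sub>F n in sequentially. M (Suc n) \<subseteq> Q"
        using M0 by (intro MD(7)) auto
      then show "\<forall>\<^sub>F n in sequentially. e n \<in> Q"
        by eventually_elim (use e in blast)
    qed
    show "- d n + e n \<in> N" for n
      using e[of n] le_funD[OF M(2), of "Suc n"] by (auto simp: F0_def)
  qed
qed

section \<open>Nontrivial convergent sequences\<close>

lemma conv_seq_model_cases:
  assumes "t \<in> conv_seq_model"
  obtains "t = 0" | n where "n \<ge> 1" "t = 1 / real n"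
  using assms unfolding conv_seq_model_def by blast

lemma compact_conv_seq_model: "compact conv_seq_model"
proof -
  have "conv_seq_model = insert 0 (range (\<lambda>n. inverse (real (Suc n))))"
  proof -
    have "{1 / real n |n. n \<ge> 1} = range (\<lambda>n. inverse (real (Suc n)))"
    proof
      show "{1 / real n |n. n \<ge> 1} \<subseteq> range (\<lambda>n. inverse (real (Suc n)))"
      proof
        fix t assume "t \<in> {1 / real n |n. n \<ge> 1}"
        then obtain n where "n \<ge> 1" "t = 1 / real n"
          by blast
        then show "t \<in> range (\<lambda>n. inverse (real (Suc n)))"
          by (intro image_eqI[of _ _ "n - 1"]) (simp_all add: inverse_eq_divide)
      qed
      show "range (\<lambda>n. inverse (real (Suc n))) \<subseteq> {1 / real n |n. n \<ge> 1}"
        by (metis (mono_tags, lifting) One_nat_def Suc_le_mono image_subsetI inverse_eq_divide le0 mem_Collect_eq)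
    qed
    then show ?thesis
      by (simp add: conv_seq_model_def)
  qed
  then show ?thesis
    using compact_sequence_with_limit[OF LIMSEQ_inverse_real_of_nat] by simp
qed

text \<open>The expression \<open>nat \<lfloor>1 / t\<rfloor>\<close> recovers \<open>n\<close> from
  \<open>t = 1 / n\<close>, so the map sends \<open>1 / n\<close> to \<open>y n\<close>.\<close>

lemma continuous_on_conv_seq_model:
  fixes y :: "nat \<Rightarrow> 'a::topological_space"
  assumes "y \<longlonglongrightarrow> l"
  shows "continuous_on conv_seq_model (\<lambda>t. if t = 0 then l else y (nat \<lfloor>1 / t\<rfloor>))"
    (is "continuous_on _ ?f")
  unfolding continuous_on_def
proof
  fix t assume "t \<in> conv_seq_model"
  then show "(?f \<longlongrightarrow> ?f t) (at t within conv_seq_model)"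
  proof (cases rule: conv_seq_model_cases)
    case 1
    show ?thesis
    proof (rule topological_tendstoI)
      fix Q assume Q: "open Q" "?f t \<in> Q"
      then obtain m where m: "\<And>n. n \<ge> m \<Longrightarrow> y n \<in> Q"
        using topological_tendstoD[OF assms, of Q] 1 by (auto simp: eventually_sequentially)
      \<comment> \<open>A point \<open>1 / n\<close> within \<open>1 / Suc m\<close> of 0 has
        \<open>n > Suc m\<close>; the successor keeps the radius meaningful when
        \<open>m = 0\<close>.\<close>
      show "\<forall>\<^sub>F s in at t within conv_seq_model. ?f s \<in> Q"
        unfolding eventually_at
      proof (intro exI[of _ "1 / real (Suc m)"] conjI ballI impI)
        fix s assume s: "s \<in> conv_seq_model" "s \<noteq> t \<and> dist s t < 1 / real (Suc m)"
        from s(1) show "?f s \<in> Q"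
        proof (cases rule: conv_seq_model_cases)
          case (2 n)
          then have "1 / real n < 1 / real (Suc m)"
            using s(2) 1 by (simp add: dist_real_def)
          then have "m \<le> n"
            using 2 by (simp add: frac_less2 field_simps)
          then show ?thesis
            using 2 m by simp
        qed (use s 1 in simp)
      qed simp
    qed
  next
    case (2 n)
    have "((\<lambda>s. 1 / s) \<longlongrightarrow> 1 / t) (at t within conv_seq_model)"
      using 2 by (intro tendsto_intros) auto
    then have lim: "((\<lambda>s. 1 / s) \<longlongrightarrow> real n) (at t within conv_seq_model)"
      using 2 by simp
    have "\<forall>\<^sub>F s in at t within conv_seq_model. s \<in> conv_seq_model"
      by (simp add: eventually_at_filter)
    \<comment> \<open>The point \<open>t = 1 / n\<close> is isolated: an integer within 1/2 of
      \<open>n\<close> equals \<open>n\<close>. The point \<open>s = 0\<close> is excluded too,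
      because \<open>1 / 0 = 0\<close> by convention.\<close>
    moreover have "\<forall>\<^sub>F s in at t within conv_seq_model. real n - 1 / 2 < 1 / s"
      "\<forall>\<^sub>F s in at t within conv_seq_model. 1 / s < real n + 1 / 2"
      by (rule order_tendstoD[OF lim]; simp)+
    ultimately have "\<forall>\<^sub>F s in at t within conv_seq_model. ?f s = ?f t"
    proof eventually_elim
      case (elim s)
      from elim(1) show ?case
      proof (cases rule: conv_seq_model_cases)
        case 1
        then show ?thesis using elim(2) 2 by simp
      next
        case s: (2 k)
        then have "real n - 1 / 2 < real k" "real k < real n + 1 / 2"
          using elim by simp_all
        then have "k = n"
          by linarith
        then show ?thesis
          using s 2 by simp
      qed
    qed
    then show ?thesis
      by (rule tendsto_eventually)
  qed
qed

text \<open>Subtracting the limit moves a convergent sequence to 0. Conversely, \<open>a\<close> may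
  repeat values, so an injective subsequence is extracted; the resulting continuous injection of the
  compact model into a Hausdorff space is a homeomorphism onto its image.\<close>

lemma contains_nontrivial_convseq_iff:
  assumes haus: "Hausdorff_space (euclidean :: 'a::{topological_group_add, t1_space} topology)"
  shows "contains_nontrivial_convseq (euclidean :: 'a topology) \<longleftrightarrow>
    (\<exists>a :: nat \<Rightarrow> 'a. (\<forall>n. a n \<noteq> 0) \<and> a \<longlonglongrightarrow> 0)"
proof
  assume "contains_nontrivial_convseq (euclidean :: 'a topology)"
  then obtain S :: "'a set" where "top_of_set conv_seq_model homeomorphic_space top_of_set S"
    unfolding contains_nontrivial_convseq_def using homeomorphic_space_sym by blast
  then obtain f where f: "homeomorphic_map (top_of_set conv_seq_model) (top_of_set S) f"
    unfolding homeomorphic_space by blast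
  then have cont: "continuous_on conv_seq_model f" and inj: "inj_on f conv_seq_model"
    using homeomorphic_imp_continuous_map[OF f] homeomorphic_imp_injective_map[OF f]
    by (auto simp: continuous_map_in_subtopology)
  have model: "0 \<in> conv_seq_model" "inverse (real (Suc n)) \<in> conv_seq_model" for n
    unfolding conv_seq_model_def inverse_eq_divide by (blast, force)
  have "(\<lambda>n. f (inverse (real (Suc n)))) \<longlonglongrightarrow> f 0"
    using model by (intro continuous_on_tendsto_compose[OF cont LIMSEQ_inverse_real_of_nat]) auto
  then have "(\<lambda>n. f (inverse (real (Suc n))) - f 0) \<longlonglongrightarrow> f 0 - f 0"
    by (intro tendsto_diff tendsto_const)
  moreover have "f (inverse (real (Suc n))) - f 0 \<noteq> 0" for n
    using inj_onD[OF inj, of "inverse (real (Suc n))" 0] model by auto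
  ultimately show "\<exists>a :: nat \<Rightarrow> 'a. (\<forall>n. a n \<noteq> 0) \<and> a \<longlonglongrightarrow> 0"
    by (intro exI[of _ "\<lambda>n. f (inverse (real (Suc n))) - f 0"]) simp
next
  assume "\<exists>a :: nat \<Rightarrow> 'a. (\<forall>n. a n \<noteq> 0) \<and> a \<longlonglongrightarrow> 0"
  then obtain a :: "nat \<Rightarrow> 'a" where a: "\<And>n. a n \<noteq> 0" "a \<longlonglongrightarrow> 0"
    by blast
  \<comment> \<open>Finite sets are closed in a T_1 space, so the terms eventually avoid the
    finitely many nonzero values used before. Each new index therefore gives a new value.\<close>
  have "\<exists>r. \<forall>n. True \<and> (r n < r (Suc n) \<and> (\<forall>i\<le>r n. a (r (Suc n)) \<noteq> a i))"
  proof (rule dependent_nat_choice)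
    fix k n :: nat
    have "open (- a ` {..k})" "0 \<in> - a ` {..k}"
      using a(1) by (auto simp: open_Compl finite_imp_closed)
    then have "\<forall>\<^sub>F n in sequentially. a n \<in> - a ` {..k}"
      by (rule topological_tendstoD[OF a(2)])
    then obtain m where "\<And>n. n \<ge> m \<Longrightarrow> a n \<in> - a ` {..k}"
      by (auto simp: eventually_sequentially)
    then have "a (max m (Suc k)) \<in> - a ` {..k}"
      by simp
    then show "\<exists>j. True \<and> (k < j \<and> (\<forall>i\<le>k. a j \<noteq> a i))"
      by (intro exI[of _ "max m (Suc k)"]) auto
  qed simp
  then obtain r where r: "\<And>n. r n < r (Suc n)" "\<And>n i. i \<le> r n \<Longrightarrow> a (r (Suc n)) \<noteq> a i"
    by metis
  have mono: "strict_mono r"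
    using r(1) by (simp add: strict_mono_Suc_iff)
  let ?y = "\<lambda>n. a (r n)"
  have neq: "?y i \<noteq> ?y j" if ij: "i < j" for i j
  proof -
    obtain k where k: "j = Suc k" "i \<le> k"
      using ij by (cases j) auto
    then show ?thesis
      using r(2)[of "r i" k] strict_mono_less_eq[OF mono] by simp
  qed
  have "?y \<longlonglongrightarrow> 0"
    using LIMSEQ_subseq_LIMSEQ[OF a(2) mono] by (simp add: o_def)
  define f where "f t = (if t = 0 then 0 else ?y (nat \<lfloor>1 / t\<rfloor>))" for t :: real
  have cont: "continuous_on conv_seq_model f"
    unfolding f_def by (rule continuous_on_conv_seq_model) fact
  have inj: "inj_on f conv_seq_model"
  proof (rule inj_onI)
    fix s t assume st: "s \<in> conv_seq_model" "t \<in> conv_seq_model" "f s = f t"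
    from st(1,2) show "s = t"
      by (elim conv_seq_model_cases; use st(3) a(1) neq in \<open>auto simp: f_def\<close>) (metis linorder_neqE_nat)
  qed
  have "homeomorphic_map (top_of_set conv_seq_model) (top_of_set (f ` conv_seq_model)) f"
  proof (rule continuous_imp_homeomorphic_map)
    show "continuous_map (top_of_set conv_seq_model) (top_of_set (f ` conv_seq_model)) f"
      using cont by (simp add: continuous_map_in_subtopology image_subset_iff_funcset[symmetric])
    show "compact_space (top_of_set conv_seq_model)"
      using compact_conv_seq_model by (simp add: compact_space_subtopology)
    show "Hausdorff_space (top_of_set (f ` conv_seq_model))"
      using haus by (rule Hausdorff_space_subtopology)
  qed (use inj in auto)
  then show "contains_nontrivial_convseq (euclidean :: 'a topology)"
    unfolding contains_nontrivial_convseq_def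
    by (metis homeomorphic_map_imp_homeomorphic_space homeomorphic_space_sym subset_UNIV topspace_euclidean)
qed

section \<open>Hereditarily normal groups\<close>

lemma hereditarily_normal_imp_Hausdorff:
  assumes "hereditarily normal_space (euclidean :: 'a::t1_space topology)"
  shows "Hausdorff_space (euclidean :: 'a topology)"
proof -
  have "t1_space (euclidean :: 'a topology)"
    by (simp add: t1_space_closedin_singleton)
  then show ?thesis
    using assms hereditarily_inc normal_t1_imp_Hausdorff_space by blast
qed

text \<open>The condition \<open>a n \<notin> W n\<close> makes the intersection miss the whole
  sequence: for a convergent sequence only 0 is left, and in the compact case no \<open>a n\<close>
  lies in the subgroup found inside the intersection.\<close>

lemma hereditarily_normal_cluster_gdelta:
  fixes a :: "nat \<Rightarrow> 'a::{topological_group_add, t1_space}"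
  assumes hn: "hereditarily normal_space (euclidean :: 'a topology)"
    and a: "\<And>n. a n \<noteq> 0" "0 \<in> closure (range a)"
  shows "\<exists>W. (\<forall>n. open (W n) \<and> 0 \<in> W n \<and> a n \<notin> W n) \<and> \<Inter>(range W) \<subseteq> closure (range a)"
proof -
  \<comment> \<open>Regularity at 0: in a subgroup chain avoiding \<open>a n\<close>, the closure of
    \<open>W 1\<close> lies in \<open>W 0\<close>.\<close>
  have "\<exists>U. open U \<and> 0 \<in> U \<and> a n \<notin> closure U" for n
  proof -
    have *: "open (UNIV - {a n})" "0 \<in> UNIV - {a n}"
      using a(1)[of n] by auto
    obtain W where W: "subgroup_chain W" "\<And>k. W k \<subseteq> UNIV - {a n}"
      using subgroup_chain_exists[of "\<lambda>_. UNIV - {a n}"] * by blast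
    have "open (W 1)" "0 \<in> W 1"
      using W(1) by (auto simp: subgroup_chain_def)
    moreover have "a n \<notin> closure (W 1)"
      using subgroup_chain_closure[OF W(1), of 0] W(2)[of 0] by auto
    ultimately show ?thesis
      by blast
  qed
  then obtain U where U: "\<And>n. open (U n)" "\<And>n. 0 \<in> U n" "\<And>n. a n \<notin> closure (U n)"
    by metis
  \<comment> \<open>Here \<open>\<Inter>(range U)\<close> is the G_delta set \<open>H\<close>; the
    closure of \<open>?S\<close> lies in each \<open>closure (U n)\<close> and so misses every
    \<open>a n\<close>.\<close>
  let ?S = "\<Inter>(range U) - closure (range a)"
  have "closure ?S \<subseteq> closure (U n)" for n
    by (intro closure_mono) auto
  then have "separatedin euclidean ?S (range a)"
    using U(3) closure_subset[of "range a"] by (auto simp: separatedin_def)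
  then obtain A B where AB: "open A" "open B" "?S \<subseteq> A" "range a \<subseteq> B" "disjnt A B"
    using hn unfolding hereditarily_normal_separation by (metis open_openin)
  show ?thesis
  proof (intro exI[of _ "\<lambda>n. U n \<inter> {x. a n + x \<in> B}"] conjI allI)
    show "open (U n \<inter> {x. a n + x \<in> B})" for n
      using U(1) AB(2) by (intro open_Int open_add_preimage)
    show "0 \<in> U n \<inter> {x. a n + x \<in> B}" for n
      using U(2) AB(4) by auto
    show "a n \<notin> U n \<inter> {x. a n + x \<in> B}" for n
      using U(3)[of n] closure_subset[of "U n"] by auto
    show "(\<Inter>n. U n \<inter> {x. a n + x \<in> B}) \<subseteq> closure (range a)"
    proof (rule subsetI, rule ccontr)
      fix h assume h: "h \<in> (\<Inter>n. U n \<inter> {x. a n + x \<in> B})" "h \<notin> closure (range a)"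
      then have "h \<in> A"
        using AB(3) by blast
      \<comment> \<open>Right translation by \<open>h\<close> carries the cluster point 0 of
        \<open>a\<close> to \<open>h\<close>, so some \<open>a n + h\<close> falls into
        \<open>A\<close>, although it lies in \<open>B\<close>.\<close>
      then have "open {x. x + h \<in> A}" "0 \<in> {x. x + h \<in> A}"
        using AB(1) open_add_preimage(2) by auto
      then obtain n where "a n + h \<in> A"
        using a(2) open_Int_closure_eq_empty[of "{x. x + h \<in> A}" "range a"] by blast
      then show False
        using h(1) AB(5) by (auto simp: disjnt_def)
    qed
  qed
qed

text \<open>A convergent sequence together with its limit is compact, hence closed, so the closure
  of the range adds nothing but 0. The G_delta set from the clustering argument then shrinks to
  0.\<close>

lemma convergent_sequence_imp_zero_gdelta:
  fixes a :: "nat \<Rightarrow> 'a::{topological_group_add, t1_space}"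
  assumes hn: "hereditarily normal_space (euclidean :: 'a topology)"
    and a: "\<And>n. a n \<noteq> 0" "a \<longlonglongrightarrow> 0"
  shows "gdelta_in euclidean {0::'a}"
proof -
  have tail: "\<exists>n. a n \<in> Q" if "open Q" "0 \<in> Q" for Q
    using topological_tendstoD[OF a(2) that] by (auto simp: eventually_sequentially)
  have "0 \<in> closure (range a)"
  proof (rule ccontr)
    assume "0 \<notin> closure (range a)"
    then obtain n where "a n \<in> - closure (range a)"
      using tail[of "- closure (range a)"] by auto
    then show False
      using closure_subset[of "range a"] by auto
  qed
  then obtain W where W: "\<And>n. open (W n)" "\<And>n. 0 \<in> W n" "\<And>n. a n \<notin> W n" "\<Inter>(range W) \<subseteq> closure (range a)"
    using hereditarily_normal_cluster_gdelta[where a = a, OF hn a(1)] by blast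
  have "compact (insert 0 (range a))"
  proof (rule compactI)
    fix \<C> assume \<C>: "\<forall>Q\<in>\<C>. open Q" "insert 0 (range a) \<subseteq> \<Union>\<C>"
    then obtain Q where Q: "Q \<in> \<C>" "0 \<in> Q"
      by blast
    then obtain m where m: "\<And>n. n \<ge> m \<Longrightarrow> a n \<in> Q"
      using topological_tendstoD[OF a(2), of Q] \<C>(1) by (auto simp: eventually_sequentially)
    have "\<forall>n. \<exists>P\<in>\<C>. a n \<in> P"
      using \<C>(2) by blast
    then obtain P where P: "\<And>n. P n \<in> \<C>" "\<And>n. a n \<in> P n"
      by metis
    have "insert 0 (range a) \<subseteq> \<Union>(insert Q (P ` {..<m}))"
      using Q(2) P(2) m by (auto simp: not_less[symmetric])
    then show "\<exists>\<D>\<subseteq>\<C>. finite \<D> \<and> insert 0 (range a) \<subseteq> \<Union>\<D>"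
      using Q(1) P(1) by (intro exI[of _ "insert Q (P ` {..<m})"]) auto
  qed
  then have "closed (insert 0 (range a))"
    using compactin_imp_closedin[OF hereditarily_normal_imp_Hausdorff[OF hn]] by simp
  then have "closure (range a) \<subseteq> insert 0 (range a)"
    by (intro closure_minimal) auto
  then have "\<Inter>(range W) = {0}"
    using W(2-4) by auto
  moreover have "gdelta_in euclidean (\<Inter>(range W))"
    using W(1) by (intro gdelta_in_Inter) (auto intro: open_imp_gdelta_in)
  ultimately show ?thesis
    by simp
qed

text \<open>A limit point of a countable subset of \<open>K\<close>, translated to 0, gives a
  sequence known only to cluster at 0. Terms \<open>a (r k)\<close> chosen from \<open>W k\<close>
  converge modulo a compact subgroup, and lifting turns this into genuine convergence.\<close>

lemma infinite_compact_imp_convergent_sequence: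
  fixes K :: "'a::{topological_group_add, t1_space} set"
  assumes hn: "hereditarily normal_space (euclidean :: 'a topology)"
    and K: "compact K" "infinite K"
  obtains a where "\<And>n::nat. a n \<noteq> 0" "a \<longlonglongrightarrow> (0::'a)"
proof -
  obtain b :: "nat \<Rightarrow> 'a" where b: "inj b" "range b \<subseteq> K"
    using K(2) infinite_countable_subset by blast
  then obtain p where p: "p islimpt range b"
    using Heine_Borel_imp_Bolzano_Weierstrass[OF K(1), of "range b"] finite_imageD by blast
  \<comment> \<open>The limit point \<open>p\<close> may itself be a value of \<open>b\<close>; it
    is removed so that the differences \<open>c n - p\<close> are nonzero.\<close>
  have "range b - {p} \<noteq> {}"
    using p islimptE[of p "range b" UNIV] by blast
  moreover have "countable (range b - {p})"
    by simp
  ultimately obtain c :: "nat \<Rightarrow> 'a" where c: "range c = range b - {p}"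
    using uncountable_def by blast
  define a where "a n = c n - p" for n
  have a0: "a n \<noteq> 0" for n
    using c by (auto simp: a_def)
  have ex: "\<exists>n. a n \<in> Q" if Q: "open Q" "0 \<in> Q" for Q
  proof -
    have "open {x. x - p \<in> Q}" "p \<in> {x. x - p \<in> Q}"
      using open_add_preimage(2)[OF Q(1), of "- p"] Q(2) by auto
    then obtain y where y: "y \<in> range b" "y \<noteq> p" "y \<in> {x. x - p \<in> Q}"
      using islimptE[OF p] by metis
    then have "y \<in> range c"
      using c by simp
    then show ?thesis
      using y(3) unfolding a_def by auto
  qed
  have "0 \<in> closure (range a)"
  proof (rule ccontr)
    assume "0 \<notin> closure (range a)"
    then obtain n where "a n \<in> - closure (range a)"
      using ex[of "- closure (range a)"] by auto
    then show False
      using closure_subset[of "range a"] by auto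
  qed
  then obtain U where U: "\<And>n. open (U n)" "\<And>n. 0 \<in> U n" "\<And>n. a n \<notin> U n" "\<Inter>(range U) \<subseteq> closure (range a)"
    using hereditarily_normal_cluster_gdelta[where a = a, OF hn a0] by blast
  obtain W where W: "subgroup_chain W" "\<And>n. W n \<subseteq> U n"
    using subgroup_chain_exists[of U] U(1,2) by blast
  note WI = subgroup_chain_Inter[OF W(1)]
  \<comment> \<open>The translate of \<open>K\<close> contains every \<open>a n\<close>; being
    closed, it also contains their closure and hence the subgroup
    \<open>\<Inter>(range W)\<close>.\<close>
  define L where "L = (\<lambda>x. x + - p) ` K"
  have L: "compact L"
    unfolding L_def by (rule compact_add_image(2)[OF K(1)])
  then have "closed L"
    using compactin_imp_closedin[OF hereditarily_normal_imp_Hausdorff[OF hn]] by simp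
  have aL: "a n \<in> L" for n
  proof -
    have "c n \<in> K"
      using b(2) c by (metis Diff_subset rangeI subset_iff)
    then show ?thesis
      by (simp add: L_def a_def)
  qed
  then have "closure (range a) \<subseteq> L"
    using \<open>closed L\<close> by (intro closure_minimal) auto
  then have NL: "\<Inter>(range W) \<subseteq> L"
    using U(4) W(2) by blast
  then have "compact (\<Inter>(range W))"
    using compact_Int_closed[OF L WI(3)] by (simp add: Int_absorb1)
  have "\<forall>k. \<exists>n. a n \<in> W k"
    using ex W(1) by (auto simp: subgroup_chain_def)
  then obtain r where r: "\<And>k. a (r k) \<in> W k"
    by metis
  have "\<forall>\<^sub>F n in sequentially. a (r n) \<in> Q" if Q: "open Q" "\<Inter>(range W) \<subseteq> Q" for Q
  proof -
    obtain k where "L \<inter> closure (W k) \<subseteq> Q"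
      using subgroup_chain_compact[OF W(1) L Q(1)] Q(2) by blast
    then have "a (r n) \<in> Q" if "n \<ge> k" for n
      using r[of n] subgroup_chain_antimono[OF W(1) that] aL closure_subset[of "W k"] by blast
    then show ?thesis
      by (auto simp: eventually_sequentially)
  qed
  then obtain e where e: "e \<longlonglongrightarrow> 0" "\<And>n. - a (r n) + e n \<in> \<Inter>(range W)"
    using compact_subgroup_lift_sequence[OF WI(1,2) \<open>compact (\<Inter>(range W))\<close> WI(3), of "\<lambda>n. a (r n)"]
    by metis
  \<comment> \<open>If \<open>e n\<close> were 0, then \<open>a (r n)\<close> would belong to the
    subgroup, which lies in \<open>U (r n)\<close> and so misses it.\<close>
  have "e n \<noteq> 0" for n
  proof
    assume "e n = 0"
    then have "- a (r n) \<in> \<Inter>(range W)"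
      using e(2)[of n] by simp
    then have "a (r n) \<in> \<Inter>(range W)"
      using subgroup_add(1)[OF WI(1,2)] by fastforce
    then show False
      using W(2) U(3) by blast
  qed
  then show thesis
    using e(1) that by blast
qed

text \<open>The diagonal is the preimage of 0 under the continuous map of subtraction.\<close>

lemma zero_gdelta_imp_has_gdelta_diagonal:
  assumes "gdelta_in euclidean {0 :: 'a::topological_group_add}"
  shows "has_gdelta_diagonal (euclidean :: 'a topology)"
proof -
  obtain C where C: "\<And>n::nat. open (C n)" "\<Inter>(range C) = {0::'a}"
    using assms by (auto simp: gdelta_in_descending)
  have "open ((\<lambda>p::'a \<times> 'a. fst p - snd p) -` C n)" for n
    by (intro open_vimage C continuous_intros)
  then have "gdelta_in euclidean (\<Inter>(range (\<lambda>n. (\<lambda>p::'a \<times> 'a. fst p - snd p) -` C n)))"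
    by (intro gdelta_in_Inter) (auto intro: open_imp_gdelta_in)
  moreover have "(\<Inter>(range (\<lambda>n. (\<lambda>p::'a \<times> 'a. fst p - snd p) -` C n))) = range (\<lambda>x. (x, x))"
  proof -
    have "(\<Inter>(range (\<lambda>n. (\<lambda>p::'a \<times> 'a. fst p - snd p) -` C n))) = (\<lambda>p. fst p - snd p) -` (\<Inter>(range C))"
      by blast
    also have "\<dots> = range (\<lambda>x. (x, x))"
      unfolding C(2) by (auto simp: vimage_def)
    finally show ?thesis .
  qed
  ultimately show ?thesis
    by (simp add: has_gdelta_diagonal_def)
qed

theorem theorem2p10:
  assumes "hereditarily normal_space (euclidean :: 'a::{topological_group_add, t1_space} topology)"
  shows "((contains_nontrivial_convseq (euclidean :: 'a topology) \<and>
            has_gdelta_diagonal (euclidean :: 'a topology))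
         \<or> (\<not> contains_nontrivial_convseq (euclidean :: 'a topology) \<and>
            (\<forall>K :: 'a set. compact K \<longrightarrow> finite K)))
         \<and> (\<forall>K :: 'a set. compact K \<longrightarrow> metrizable_space (subtopology euclidean K))"
proof -
  note haus = hereditarily_normal_imp_Hausdorff[OF assms]
  show ?thesis
  proof (cases "contains_nontrivial_convseq (euclidean :: 'a topology)")
    case True
    then obtain a :: "nat \<Rightarrow> 'a" where "\<And>n. a n \<noteq> 0" "a \<longlonglongrightarrow> 0"
      using contains_nontrivial_convseq_iff[OF haus] by blast
    then have diag: "has_gdelta_diagonal (euclidean :: 'a topology)"
      using convergent_sequence_imp_zero_gdelta[OF assms] zero_gdelta_imp_has_gdelta_diagonal by blast
    have "metrizable_space (top_of_set K)" if "compact K" for K :: "'a set"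
      using that haus diag
      by (intro compact_Hausdorff_gdelta_diagonal_imp_metrizable has_gdelta_diagonal_subtopology
          Hausdorff_space_subtopology) (simp_all add: compact_space_subtopology)
    with True diag show ?thesis
      by blast
  next
    case False
    then have fin: "finite K" if "compact K" for K :: "'a set"
      using that infinite_compact_imp_convergent_sequence[OF assms]
        contains_nontrivial_convseq_iff[OF haus] by metis
    have "metrizable_space (top_of_set K)" if "compact K" for K :: "'a set"
    proof -
      have "top_of_set K = discrete_topology K"
        using fin[OF that] haus
        by (metis Hausdorff_space_subtopology finite_topspace_imp_discrete_topology topspace_euclidean_subtopology)
      then show ?thesis
        by (simp add: metrizable_space_discrete_topology)
    qed
    with False fin show ?thesis
      by blast
  qed
qed

end
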